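(* Let $N,K\ge1$ and let $p_1,\dots,p_K\in\Sigma_N$. For $k\in\{1,\dots,K\}$ let $\mathcal C_k=\{\gamma\in\mathbb R_+^{N^K}: S_k(\gamma)=p_k\}$. Let $\bar\gamma\in\mathbb R^{N^K}$ be an array with strictly positive entries. Then for any $k\in\{1,\dots,K\}$, denoting by $\gamma=P^{\mathrm{KL}}_{\mathcal C_k}(\bar\gamma)=\operatorname{argmin}_{\gamma\in\mathcal C_k}\mathrm{KL}(\gamma|\bar\gamma)$ the Kullback-Leibler projection of $\bar\gamma$ on $\mathcal C_k$, one has $$\forall j=(j_1,\dots,j_K)\in\{1,\dots,N\}^K,\qquad \gamma_j=\frac{(p_k)_{j_k}}{S_k(\bar\gamma)_{j_k}}\,\bar\gamma_j.$$
   Context: $\mathbb R_+=[0,\infty)$ and $\Sigma_N=\{p\in\mathbb R_+^N:\sum_ip_i=1\}$. Elements $\gamma$ of $\mathbb R^{N^K}$ are $K$-dimensional arrays $(\gamma_j)$ indexed by $j=(j_1,\dots,j_K)\in\{1,\dots,N\}^K$. The $k$-th push-forward $S_k(\gamma)\in\mathbb R^N$ is $S_k(\gamma)_i=\sum_{j:\,j_k=i}\gamma_j$ for $i\in\{1,\dots,N\}$. For $\gamma\in\mathbb R_+^{N^K}$ and $\xi\in\mathbb R^{N^K}$ with strictly positive entries, $\mathrm{KL}(\gamma|\xi)=\sum_j\gamma_j(\log(\gamma_j/\xi_j)-1)$, with the convention $0\log0=0$. *)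

theory Defs
  imports "HOL-Analysis.Analysis"
begin

text \<open>
  The sizes \<open>N\<close> and \<open>K\<close> are the cardinalities of the finite types \<open>'n\<close> and \<open>'k\<close>.  A multi-index
  \<open>j = (j\<^sub>1, \<dots>, j\<^sub>K)\<close> is a vector \<open>j :: 'n ^ 'k\<close> with components \<open>j $ k\<close>, so that a
  \<open>K\<close>-dimensional array is a vector of type \<open>real ^ ('n ^ 'k)\<close>.
\<close>

definition prob_simplex :: "(real ^ 'n) set" where
  "prob_simplex = {p. (\<forall>i. 0 \<le> p $ i) \<and> (\<Sum>i\<in>UNIV. p $ i) = 1}"

definition push_forward :: "'k \<Rightarrow> real ^ ('n::finite ^ 'k::finite) \<Rightarrow> real ^ 'n" where
  "push_forward k \<gamma> = (\<chi> i. \<Sum>j | j $ k = i. \<gamma> $ j)"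

definition marginal_constraint ::
    "'k \<Rightarrow> real ^ 'n \<Rightarrow> (real ^ ('n::finite ^ 'k::finite)) set" where
  "marginal_constraint k q = {\<gamma>. (\<forall>j. 0 \<le> \<gamma> $ j) \<and> push_forward k \<gamma> = q}"

text \<open>
  The convention \<open>0 log 0 = 0\<close> needs no case distinction: a summand with \<open>\<gamma> $ j = 0\<close> is a product
  with the factor \<open>0\<close>.  The definition is only meaningful for \<open>\<gamma>\<close> with nonnegative and \<open>\<xi>\<close> with
  strictly positive entries.
\<close>

definition KL :: "real ^ ('n::finite ^ 'k::finite) \<Rightarrow> real ^ ('n ^ 'k) \<Rightarrow> real" where
  "KL \<gamma> \<xi> = (\<Sum>j\<in>UNIV. \<gamma> $ j * (ln (\<gamma> $ j / \<xi> $ j) - 1))"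

text \<open>
  \<^const>\<open>arg_min\<close> is a choice among all minimisers; it denotes the projection only where the
  minimiser exists and is unique.
\<close>

definition KL_proj ::
    "(real ^ ('n::finite ^ 'k::finite)) set \<Rightarrow> real ^ ('n ^ 'k) \<Rightarrow> real ^ ('n ^ 'k)" where
  "KL_proj C \<xi> = arg_min (\<lambda>\<gamma>. KL \<gamma> \<xi>) (\<lambda>\<gamma>. \<gamma> \<in> C)"

end

theory Submission imports Defs begin

text \<open>
  On \<open>C\<^sub>k\<close> the linear functional \<open>\<gamma> \<mapsto> \<Sum>\<^sub>j \<gamma>\<^sub>j ln (a (j\<^sub>k))\<close> is constant, for any weights \<open>a\<close>.  With
  \<open>a = p\<^sub>k / S\<^sub>k(\<gamma>bar)\<close>, subtracting it from \<open>KL(\<gamma>|\<gamma>bar)\<close> leaves the divergence of \<open>\<gamma>\<close> from the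
  rescaled array \<open>g\<^sub>j = a (j\<^sub>k) \<gamma>bar\<^sub>j\<close>, which Gibbs' inequality \<open>ln u \<le> u - 1\<close> bounds termwise, with
  equality only at \<open>\<gamma> = g\<close>.  Where \<open>a\<close> vanishes, so does every \<open>\<gamma>\<close> in \<open>C\<^sub>k\<close>, which makes the junk
  value of \<open>ln 0\<close> harmless.
\<close>

text \<open>For \<open>a > 0\<close> the left-hand side is the tangent line at
  \<open>x = a * y\<close> to the convex function \<open>x * (ln (x / y) - 1)\<close>, which touches
  it only there. For \<open>a = 0\<close> the last hypothesis forces \<open>x = 0\<close>.\<close>

lemma KL_term_lower_bound:
  fixes x y a :: real
  assumes "0 \<le> x" "0 < y" "0 \<le> a" "a = 0 \<Longrightarrow> x = 0"
  shows "x * ln a - a * y \<le> x * (ln (x / y) - 1)"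
    and "x * (ln (x / y) - 1) = x * ln a - a * y \<longleftrightarrow> x = a * y"
proof -
  have "x * ln a - a * y \<le> x * (ln (x / y) - 1) \<and>
    (x * (ln (x / y) - 1) = x * ln a - a * y \<longleftrightarrow> x = a * y)"
  proof (cases "x = 0")
    case True
    then show ?thesis using assms by auto
  next
    case False
    then have x: "0 < x" and a: "0 < a"
      using assms by (auto simp: less_le)
    \<comment> \<open>This ratio of the rescaled entry to \<open>x\<close> turns the gap between the
      two sides into \<open>x * (u - 1 - ln u)\<close>.\<close>
    define u where "u = a * y / x"
    have u: "0 < u" using x a \<open>0 < y\<close> by (simp add: u_def)
    have xu: "x * u = a * y" using x by (simp add: u_def)
    have ln_u: "ln u = ln a - ln (x / y)"
      using x a \<open>0 < y\<close> by (simp add: u_def ln_mult ln_div)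
    have diff: "x * (ln (x / y) - 1) - (x * ln a - a * y) = x * (u - 1 - ln u)"
      unfolding ln_u using xu by (simp add: algebra_simps)
    have "0 \<le> x * (u - 1 - ln u)"
      using x ln_le_minus_one[OF u] by simp
    moreover have "x * (u - 1 - ln u) = 0 \<longleftrightarrow> u = 1"
      using x ln_eq_minus_one[OF u] by auto
    moreover have "u = 1 \<longleftrightarrow> x = a * y"
      using x by (auto simp: u_def field_simps)
    ultimately show ?thesis using diff by linarith
  qed
  then show "x * ln a - a * y \<le> x * (ln (x / y) - 1)"
    and "x * (ln (x / y) - 1) = x * ln a - a * y \<longleftrightarrow> x = a * y" by auto
qed

text \<open>Group the multi-indices by their \<open>k\<close>-th component. Hence a functional whose
  weights depend only on \<open>j $ k\<close> sees \<open>\<gamma>\<close> only through its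
  marginal.\<close>

lemma sum_push_forward:
  fixes \<gamma> :: "real ^ ('n::finite ^ 'k::finite)"
  shows "(\<Sum>j\<in>UNIV. f (j $ k) * \<gamma> $ j) = (\<Sum>i\<in>UNIV. f i * push_forward k \<gamma> $ i)"
proof -
  have "(\<Sum>j\<in>UNIV. f (j $ k) * \<gamma> $ j) = (\<Sum>i\<in>UNIV. \<Sum>j | j $ k = i. f (j $ k) * \<gamma> $ j)"
    using sum.group[of UNIV UNIV "\<lambda>j. j $ k" "\<lambda>j. f (j $ k) * \<gamma> $ j"] by simp
  then show ?thesis by (simp add: push_forward_def sum_distrib_left)
qed

lemma push_forward_pos:
  fixes \<gamma> :: "real ^ ('n::finite ^ 'k::finite)"
  assumes "\<And>j. 0 < \<gamma> $ j"
  shows "0 < push_forward k \<gamma> $ i"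
proof -
  \<comment> \<open>The constant multi-index shows that the fibre over \<open>i\<close> is nonempty,
    so the sum of positive entries is positive.\<close>
  have "(\<chi> l. i) \<in> {j :: 'n ^ 'k. j $ k = i}" by simp
  then have "{j :: 'n ^ 'k. j $ k = i} \<noteq> {}" by blast
  then show ?thesis using assms by (simp add: push_forward_def sum_pos)
qed

text \<open>Nonnegative entries with sum zero all vanish. This provides the side condition of
  \<open>KL_term_lower_bound\<close> where the weight is zero.\<close>

lemma marginal_constraint_eq_0:
  assumes "\<gamma> \<in> marginal_constraint k q" "q $ (j $ k) = 0"
  shows "\<gamma> $ j = 0"
proof -
  have "(\<Sum>j' | j' $ k = j $ k. \<gamma> $ j') = 0"
    using assms by (auto simp: marginal_constraint_def push_forward_def)
  then show ?thesis
    using assms by (subst (asm) sum_nonneg_eq_0_iff) (auto simp: marginal_constraint_def)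
qed

text \<open>One scaling step of Sinkhorn's algorithm (iterative proportional fitting).\<close>

definition marginal_rescale ::
    "'k \<Rightarrow> real ^ 'n \<Rightarrow> real ^ ('n::finite ^ 'k::finite) \<Rightarrow> real ^ ('n ^ 'k)" where
  "marginal_rescale k q \<xi> = (\<chi> j. q $ (j $ k) / push_forward k \<xi> $ (j $ k) * \<xi> $ j)"

lemma marginal_rescale_in_marginal_constraint:
  assumes "\<And>i. 0 \<le> q $ i" "\<And>j. 0 < \<xi> $ j"
  shows "marginal_rescale k q \<xi> \<in> marginal_constraint k q"
proof -
  have pos: "0 < push_forward k \<xi> $ i" for i
    by (rule push_forward_pos) (rule assms(2))
  have "push_forward k (marginal_rescale k q \<xi>) $ i = q $ i" for i
  proof -
    \<comment> \<open>On the fibre over \<open>i\<close> the scaling factor is constant and can be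
      pulled out of the sum.\<close>
    have "push_forward k (marginal_rescale k q \<xi>) $ i
        = (\<Sum>j | j $ k = i. q $ i / push_forward k \<xi> $ i * \<xi> $ j)"
      unfolding push_forward_def[of k "marginal_rescale k q \<xi>"]
      by (auto simp: marginal_rescale_def intro!: sum.cong)
    also have "\<dots> = q $ i / push_forward k \<xi> $ i * push_forward k \<xi> $ i"
      by (simp only: sum_distrib_left[symmetric]) (simp add: push_forward_def)
    finally show ?thesis using pos[of i] by simp
  qed
  moreover have "0 \<le> marginal_rescale k q \<xi> $ j" for j
    using assms(1) less_imp_le[OF pos] less_imp_le[OF assms(2)]
    by (simp add: marginal_rescale_def)
  ultimately show ?thesis
    by (simp add: marginal_constraint_def vec_eq_iff)
qed

lemma KL_marginal_rescale:
  assumes q: "\<And>i. 0 \<le> q $ i" and \<xi>: "\<And>j. 0 < \<xi> $ j"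
    and \<gamma>: "\<gamma> \<in> marginal_constraint k q"
  shows "KL (marginal_rescale k q \<xi>) \<xi> \<le> KL \<gamma> \<xi>"
    and "KL \<gamma> \<xi> = KL (marginal_rescale k q \<xi>) \<xi> \<longleftrightarrow> \<gamma> = marginal_rescale k q \<xi>"
proof -
  let ?g = "marginal_rescale k q \<xi>"
  define a where "a i = q $ i / push_forward k \<xi> $ i" for i
  \<comment> \<open>\<open>L\<close> is the tangent bound for the summand \<open>T\<close> of the
    divergence.\<close>
  define L where "L \<delta> j = \<delta> $ j * ln (a (j $ k)) - a (j $ k) * \<xi> $ j" for \<delta> j
  define T where "T \<delta> j = \<delta> $ j * (ln (\<delta> $ j / \<xi> $ j) - 1)" for \<delta> j
  have pos: "0 < push_forward k \<xi> $ i" for i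
    by (rule push_forward_pos) (rule \<xi>)
  have g: "?g $ j = a (j $ k) * \<xi> $ j" for j
    by (simp add: marginal_rescale_def a_def)
  have T: "L \<delta> j \<le> T \<delta> j" "T \<delta> j = L \<delta> j \<longleftrightarrow> \<delta> $ j = ?g $ j"
    if \<delta>: "\<delta> \<in> marginal_constraint k q" for \<delta> j
  proof -
    have "0 \<le> \<delta> $ j" using \<delta> by (simp add: marginal_constraint_def)
    moreover have "0 \<le> a (j $ k)" using q less_imp_le[OF pos] by (simp add: a_def)
    moreover have "\<delta> $ j = 0" if "a (j $ k) = 0"
      using that pos[of "j $ k"] marginal_constraint_eq_0[OF \<delta>] by (auto simp: a_def)
    ultimately show "L \<delta> j \<le> T \<delta> j" "T \<delta> j = L \<delta> j \<longleftrightarrow> \<delta> $ j = ?g $ j"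
      using KL_term_lower_bound[of "\<delta> $ j" "\<xi> $ j" "a (j $ k)"] \<xi>[of j]
      by (auto simp: L_def T_def g)
  qed
  \<comment> \<open>The right-hand side does not mention \<open>\<delta>\<close>: the tangent bounds
    have the same total on the whole constraint set.\<close>
  have L: "sum (L \<delta>) UNIV = (\<Sum>i\<in>UNIV. ln (a i) * q $ i) - (\<Sum>j\<in>UNIV. a (j $ k) * \<xi> $ j)"
    if "\<delta> \<in> marginal_constraint k q" for \<delta>
    using sum_push_forward[of "\<lambda>i. ln (a i)" k \<delta>] that
    by (simp add: L_def sum_subtractf marginal_constraint_def mult.commute)
  have g_in: "?g \<in> marginal_constraint k q"
    using marginal_rescale_in_marginal_constraint q \<xi> by blast
  have KL: "KL \<delta> \<xi> = sum (T \<delta>) UNIV" for \<delta>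
    by (simp add: KL_def T_def)
  have "T ?g j = L ?g j" for j
    using T(2)[OF g_in] by simp
  \<comment> \<open>At \<open>?g\<close> every bound is attained, and its total may be exchanged for
    that at \<open>\<gamma>\<close>.\<close>
  then have KL_g: "KL ?g \<xi> = sum (L \<gamma>) UNIV"
    by (simp add: KL L[OF g_in] L[OF \<gamma>])
  show "KL ?g \<xi> \<le> KL \<gamma> \<xi>"
    unfolding KL_g unfolding KL by (intro sum_mono T(1)[OF \<gamma>])
  \<comment> \<open>The termwise gaps are nonnegative, so equal totals force equality in every
    term.\<close>
  have "KL \<gamma> \<xi> = KL ?g \<xi> \<longleftrightarrow> (\<Sum>j\<in>UNIV. T \<gamma> j - L \<gamma> j) = 0"
    unfolding KL_g unfolding KL by (simp add: sum_subtractf)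
  also have "\<dots> \<longleftrightarrow> (\<forall>j. T \<gamma> j = L \<gamma> j)"
    using T(1)[OF \<gamma>] by (subst sum_nonneg_eq_0_iff) auto
  finally show "KL \<gamma> \<xi> = KL ?g \<xi> \<longleftrightarrow> \<gamma> = ?g"
    using T(2)[OF \<gamma>] by (simp add: vec_eq_iff)
qed

theorem proposition4:
  fixes p :: "'k::finite \<Rightarrow> real ^ 'n::finite"
    and \<gamma>bar :: "real ^ ('n ^ 'k)"
    and k :: 'k
  assumes "\<And>l. p l \<in> prob_simplex"
    and "\<And>j. 0 < \<gamma>bar $ j"
  shows "(\<exists>!\<gamma>. is_arg_min (\<lambda>\<gamma>. KL \<gamma> \<gamma>bar) (\<lambda>\<gamma>. \<gamma> \<in> marginal_constraint k (p k)) \<gamma>) \<and>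
    (\<forall>j. KL_proj (marginal_constraint k (p k)) \<gamma>bar $ j
          = p k $ (j $ k) / push_forward k \<gamma>bar $ (j $ k) * \<gamma>bar $ j)"
proof -
  let ?C = "marginal_constraint k (p k)" and ?g = "marginal_rescale k (p k) \<gamma>bar"
  have p: "0 \<le> p k $ i" for i
    using assms(1)[of k] by (simp add: prob_simplex_def)
  have g_in: "?g \<in> ?C"
    using marginal_rescale_in_marginal_constraint p assms(2) by blast
  have KL: "KL ?g \<gamma>bar \<le> KL \<gamma> \<gamma>bar" "KL \<gamma> \<gamma>bar = KL ?g \<gamma>bar \<longleftrightarrow> \<gamma> = ?g" if "\<gamma> \<in> ?C" for \<gamma>
    using KL_marginal_rescale[OF p assms(2) that] by auto
  \<comment> \<open>With \<open>?g\<close> as the only minimiser, the choice made by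
    \<open>arg_min\<close> is determined.\<close>
  have iff: "is_arg_min (\<lambda>\<gamma>. KL \<gamma> \<gamma>bar) (\<lambda>\<gamma>. \<gamma> \<in> ?C) \<gamma> \<longleftrightarrow> \<gamma> = ?g" for \<gamma>
    unfolding is_arg_min_linorder using g_in KL by (metis order_antisym)
  then have "KL_proj ?C \<gamma>bar = ?g"
    by (simp add: KL_proj_def arg_min_def)
  then show ?thesis
    using iff by (simp add: marginal_rescale_def)
qed

end
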